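(* Let $\Omega\subset\mathbb{R}^n$ be a domain for which there is a constant $A>0$ such that $|\Omega(x_0,\rho)|\ge A\rho^n$ for all $x_0\in\Omega$ and all $\rho<\operatorname{diam}\Omega$. Let $1\le p<\infty$ and $0<\beta\le1$. For a function $f\in L^1_{loc}(\Omega)$, the following three statements are equivalent: (1) $f\in C^{0,\beta}(\Omega)$ and $f\ge0$. (2) There exists a constant $C_1$ such that $\big|f(x)-|f(y)|\big|\le C_1|x-y|^\beta$ for almost every $x,y\in\Omega$. (3) There exists a constant $C_2$ such that for any $x_0\in\Omega$ and $0<\rho<\operatorname{diam}\Omega$, $$\Bigg(\frac{1}{|\Omega(x_0,\rho)|}\int_{\Omega(x_0,\rho)}\big|f(x)-|f|_{\Omega(x_0,\rho)}\big|^p\,dx\Bigg)^{1/p}\le C_2\rho^\beta.$$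
   Context: $Q(x,\rho)$ is the cube in $\mathbb{R}^n$ with sides parallel to the coordinate axes, center $x$ and side length $2\rho$; $\Omega(x_0,\rho):=Q(x_0,\rho)\cap\Omega$; $|f|_{E}:=\frac{1}{|E|}\int_E|f(y)|\,dy$. $C^{0,\beta}(\Omega)$ is the set of functions $f$ with $\sup_{x,y\in\Omega,\,x\ne y}\frac{|f(x)-f(y)|}{|x-y|^\beta}<\infty$. Functions that agree almost everywhere are identified, so (1) means that $f$ agrees a.e. with a nonnegative function in $C^{0,\beta}(\Omega)$. *)

theory Defs
  imports "HOL-Analysis.Analysis"
begin

definition cube :: "real ^ 'n \<Rightarrow> real \<Rightarrow> (real ^ 'n) set" where
  "cube x \<rho> = cbox (\<chi> i. x $ i - \<rho>) (\<chi> i. x $ i + \<rho>)"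

(* The library's diameter is real-valued and not meaningful on unbounded sets. *)
definition ediam :: "'a::metric_space set \<Rightarrow> ereal" where
  "ediam S = (SUP (x, y) \<in> S \<times> S. ereal (dist x y))"

definition mean :: "(real ^ 'n) set \<Rightarrow> (real ^ 'n \<Rightarrow> real) \<Rightarrow> real" where
  "mean E g = 1 / measure lebesgue E * (LINT y:E|lebesgue. g y)"

definition locally_integrable :: "(real ^ 'n) set \<Rightarrow> (real ^ 'n \<Rightarrow> real) set" where
  "locally_integrable \<Omega> = {f. \<forall>K. compact K \<and> K \<subseteq> \<Omega> \<longrightarrow> f absolutely_integrable_on K}"

(* Finiteness of the seminorm only; boundedness of f is not required. *)
definition holder_space :: "(real ^ 'n) set \<Rightarrow> real \<Rightarrow> (real ^ 'n \<Rightarrow> real) set" where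
  "holder_space \<Omega> \<beta> =
    {f. bdd_above {\<bar>f x - f y\<bar> / norm (x - y) powr \<beta> |x y. x \<in> \<Omega> \<and> y \<in> \<Omega> \<and> x \<noteq> y}}"

(* The L^p mean oscillation of f around the mean of its absolute value over E is at most B.
   The Bochner integral of a non-integrable function is 0, so the two integrability clauses
   are needed: for f merely locally integrable on an open set containing E, either integral
   may be infinite, and then the bound is to fail. *)
definition abs_oscillation_le ::
    "(real ^ 'n \<Rightarrow> real) \<Rightarrow> (real ^ 'n) set \<Rightarrow> real \<Rightarrow> real \<Rightarrow> bool" where
  "abs_oscillation_le f E p B \<longleftrightarrow>
     f absolutely_integrable_on E \<and>
     (\<lambda>x. \<bar>f x - mean E (\<lambda>y. \<bar>f y\<bar>)\<bar> powr p) absolutely_integrable_on E \<and>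
     mean E (\<lambda>x. \<bar>f x - mean E (\<lambda>y. \<bar>f y\<bar>)\<bar> powr p) powr (1 / p) \<le> B"

end

theory Submission
  imports Defs
begin

text \<open>
The implication from S1 to S2 is immediate, because \<open>\<bar>g y\<bar> = g y\<close> for nonnegative \<open>g\<close>. Given S2,
averaging the inequality over \<open>y\<close> in a cube bounds the distance of \<open>f x\<close> from the mean of \<open>\<bar>f\<bar>\<close>
by a constant times \<open>\<rho> powr \<beta>\<close> for almost every \<open>x\<close> in the cube, and S3 follows for every \<open>p\<close>
(lemma \<open>abs_oscillation_le_if_pairwise_bound\<close>).

From S3 to S1 the argument is Campanato's. The \<open>L^p\<close> bound implies an \<open>L^1\<close> bound
(\<open>L1_oscillation_le\<close>), and since the mean of \<open>\<bar>f\<bar>\<close> is nonnegative, replacing \<open>f\<close> by \<open>\<bar>f\<bar>\<close>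
does not increase the oscillation around it. Hence the means of \<open>\<bar>f\<bar>\<close> over a cube and over a cube
inside it of comparable size differ by at most a constant times \<open>\<rho> powr \<beta>\<close>, where the lower bound
for the measure of \<open>cube x \<rho> \<inter> \<Omega>\<close> is used (\<open>cube_mean_diff_le\<close>). Halving the radius repeatedly, the
means at \<open>x\<close> converge to a limit with error of order \<open>\<rho> powr \<beta>\<close> (\<open>limit_of_halving_family\<close>). The
limit is nonnegative, being a limit of means of \<open>\<bar>f\<bar>\<close>, and comparing the cubes about two points
\<open>x\<close> and \<open>y\<close> whose radii are of the order of their distance shows that it is Hoelder continuous.

It remains to see that \<open>f\<close> agrees almost everywhere with this limit. The integral of their
difference over a cube of radius \<open>r\<close> is of order \<open>r powr (n + \<beta>)\<close>, and a function with this property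
vanishes almost everywhere, as one sees by subdividing a cube into equal small cubes and adding up
(\<open>AE_zero_if_small_cube_integrals\<close>). In particular \<open>f\<close> itself, and not only \<open>\<bar>f\<bar>\<close>, is recovered:
S3 measures the distance of \<open>f\<close> from a nonnegative number and so rules out negative values.\<close>

section \<open>Cubes\<close>

lemma mem_cube_iff: "y \<in> cube x r \<longleftrightarrow> (\<forall>i. \<bar>y $ i - x $ i\<bar> \<le> r)"
  unfolding cube_def mem_box_cart vec_lambda_beta abs_le_iff
  by (rule all_cong1) (auto simp: algebra_simps)

lemma norm_diff_le_of_mem_cube:
  fixes x :: "real ^ 'n" and r :: real
  assumes "y \<in> cube x r"
  shows "norm (y - x) \<le> CARD('n) * r"
proof -
  have "norm (y - x) \<le> (\<Sum>i\<in>UNIV. \<bar>(y - x) $ i\<bar>)"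
    by (rule norm_le_l1_cart)
  also have "\<dots> \<le> (\<Sum>i\<in>(UNIV :: 'n set). r)"
    using assms by (intro sum_mono) (simp add: mem_cube_iff)
  finally show ?thesis by simp
qed

lemma norm_diff_le_of_mem_cube2:
  fixes x :: "real ^ 'n" and r :: real
  assumes "y \<in> cube x r" "z \<in> cube x r"
  shows "norm (y - z) \<le> 2 * CARD('n) * r"
  using norm_triangle_ineq4[of "y - x" "z - x"] norm_diff_le_of_mem_cube[OF assms(1)]
    norm_diff_le_of_mem_cube[OF assms(2)] by simp

lemma cube_subset_cube:
  assumes "\<And>i. \<bar>x $ i - y $ i\<bar> + r \<le> s"
  shows "cube x r \<subseteq> cube y s"
proof
  fix z assume z: "z \<in> cube x r"
  have "\<bar>z $ i - y $ i\<bar> \<le> s" for i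
    using z[unfolded mem_cube_iff, rule_format, of i] assms[of i] by linarith
  then show "z \<in> cube y s"
    by (simp add: mem_cube_iff)
qed

lemma center_mem_cube: "0 \<le> r \<Longrightarrow> x \<in> cube x r"
  by (simp add: mem_cube_iff)

lemma measure_cube:
  fixes x :: "real ^ 'n"
  assumes "0 \<le> r"
  shows "measure lebesgue (cube x r) = (2 * r) ^ CARD('n)"
proof -
  have "cube x r \<noteq> {}"
    using center_mem_cube[OF assms] by blast
  then show ?thesis
    by (simp add: cube_def content_cbox_cart)
qed

lemma lmeasurable_cube_Int_open:
  assumes "open \<Omega>"
  shows "cube x r \<inter> \<Omega> \<in> lmeasurable"
  using assms by (simp add: cube_def fmeasurable_Int_fmeasurable)

lemma measure_cube_Int_le:
  fixes \<Omega> :: "(real ^ 'n) set"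
  assumes "open \<Omega>" "0 \<le> r"
  shows "measure lebesgue (cube x r \<inter> \<Omega>) \<le> (2 * r) ^ CARD('n)"
proof -
  have "measure lebesgue (cube x r \<inter> \<Omega>) \<le> measure lebesgue (cube x r)"
    using assms by (intro measure_mono_fmeasurable) (auto simp: cube_def)
  then show ?thesis
    using assms by (simp add: measure_cube)
qed

section \<open>Densities of higher order than volume\<close>

text \<open>The small cubes are indexed by the set \<open>S\<close> of coordinates in which a point lies above the centre.
There are \<open>2 ^ CARD('n)\<close> of them, so subdividing costs exactly the factor by which the volume of a
cube drops when its side is halved.\<close>
lemma cube_subset_halves:
  fixes x :: "real ^ 'n"
  shows "cube x r \<subseteq> (\<Union>S\<in>UNIV. cube (\<chi> i. x $ i + (if i \<in> S then r / 2 else - r / 2)) (r / 2))"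
proof
  fix y assume y: "y \<in> cube x r"
  have "y \<in> cube (\<chi> i. x $ i + (if i \<in> {i. x $ i \<le> y $ i} then r / 2 else - r / 2)) (r / 2)"
    unfolding mem_cube_iff
  proof
    fix i
    show "\<bar>y $ i - (\<chi> i. x $ i + (if i \<in> {i. x $ i \<le> y $ i} then r / 2 else - r / 2)) $ i\<bar> \<le> r / 2"
      using y[unfolded mem_cube_iff, rule_format, of i] by (auto simp: abs_if split: if_splits)
  qed
  then show "y \<in> (\<Union>S\<in>UNIV. cube (\<chi> i. x $ i + (if i \<in> S then r / 2 else - r / 2)) (r / 2))"
    by blast
qed

text \<open>A density whose integral over a cube of radius \<open>r\<close> is of higher order than the volume of the
cube must vanish: cutting a cube into \<open>2 ^ (k n)\<close> cubes of radius \<open>r / 2 ^ k\<close> bounds its integral by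
\<open>2 ^ (k n) * C * (r / 2 ^ k) powr (n + \<beta>)\<close>, which is a constant times \<open>2 powr (- k \<beta>)\<close>.
This takes the place of Lebesgue's differentiation theorem in identifying a function with the limit
of its means. Integrals are nonnegative extended ones, so that large cubes, over which the integral
is not known to be finite beforehand, can be subdivided as well.\<close>
lemma AE_zero_if_small_cube_integrals:
  fixes \<phi> :: "real ^ 'n \<Rightarrow> ennreal" and C \<beta> r0 :: real
  assumes [measurable]: "\<phi> \<in> borel_measurable lebesgue"
    and C: "0 \<le> C" and \<beta>: "0 < \<beta>" and r0: "0 < r0"
    and small: "\<And>z r. 0 < r \<Longrightarrow> r < r0 \<Longrightarrow>
      (\<integral>\<^sup>+y\<in>cube z r. \<phi> y \<partial>lebesgue) \<le> ennreal (C * r powr (CARD('n) + \<beta>))"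
  shows "AE y in lebesgue. \<phi> y = 0"
proof -
  have [measurable]: "cube z r \<in> sets lebesgue" for z :: "real ^ 'n" and r
    by (simp add: cube_def)
  have refined: "(\<integral>\<^sup>+y\<in>cube z r. \<phi> y \<partial>lebesgue)
      \<le> ennreal (C * r powr (CARD('n) + \<beta>) * (2 powr (-\<beta>)) ^ k)"
    if "0 < r" "r / 2 ^ k < r0" for z r k
    using that
  proof (induction k arbitrary: z r)
    case 0
    then show ?case using small by simp
  next
    case (Suc k)
    define c where "c S = (\<chi> i. z $ i + (if i \<in> S then r / 2 else - r / 2))" for S
    have "(\<integral>\<^sup>+y\<in>cube z r. \<phi> y \<partial>lebesgue)
        \<le> (\<integral>\<^sup>+y. (\<Sum>S\<in>UNIV. \<phi> y * indicator (cube (c S) (r / 2)) y) \<partial>lebesgue)"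
    proof (rule nn_integral_mono)
      fix y
      show "\<phi> y * indicator (cube z r) y \<le> (\<Sum>S\<in>UNIV. \<phi> y * indicator (cube (c S) (r / 2)) y)"
      proof (cases "y \<in> cube z r")
        case True
        then obtain S where "y \<in> cube (c S) (r / 2)"
          using cube_subset_halves[of z r] unfolding c_def by blast
        then have "\<phi> y * indicator (cube z r) y = \<phi> y * indicator (cube (c S) (r / 2)) y"
          using True by simp
        also have "\<dots> \<le> (\<Sum>S\<in>UNIV. \<phi> y * indicator (cube (c S) (r / 2)) y)"
          by (rule member_le_sum) auto
        finally show ?thesis .
      qed simp
    qed
    also have "\<dots> = (\<Sum>S\<in>UNIV. \<integral>\<^sup>+y\<in>cube (c S) (r / 2). \<phi> y \<partial>lebesgue)"
      by (subst nn_integral_sum) auto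
    also have "\<dots> \<le> (\<Sum>S\<in>(UNIV :: 'n set set).
        ennreal (C * (r / 2) powr (CARD('n) + \<beta>) * (2 powr (-\<beta>)) ^ k))"
      using Suc by (intro sum_mono Suc.IH) (auto simp: field_simps)
    also have "\<dots> = ennreal (2 ^ CARD('n) * (C * (r / 2) powr (CARD('n) + \<beta>) * (2 powr (-\<beta>)) ^ k))"
      using C by (simp add: ennreal_mult'' card_Pow[of "UNIV :: 'n set", simplified] ennreal_power flip: ennreal_numeral)
    also have "2 ^ CARD('n) * (C * (r / 2) powr (CARD('n) + \<beta>) * (2 powr (-\<beta>)) ^ k)
        = C * r powr (CARD('n) + \<beta>) * (2 powr (-\<beta>)) ^ Suc k"
      using Suc.prems by (simp add: powr_divide powr_add powr_minus powr_realpow field_simps)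
    finally show ?case .
  qed
  have "(\<integral>\<^sup>+y\<in>cube 0 (real (Suc N)). \<phi> y \<partial>lebesgue) = 0" for N
  proof -
    define R where "R = real (Suc N)"
    have lim: "(\<lambda>k. ennreal (C * R powr (CARD('n) + \<beta>) * (2 powr (-\<beta>)) ^ k)) \<longlonglongrightarrow> ennreal (C * R powr (CARD('n) + \<beta>) * 0)"
      using \<beta> powr_less_mono[of "-\<beta>" 0 2]
      by (intro tendsto_ennrealI tendsto_mult_left LIMSEQ_power_zero) simp
    have "(\<lambda>k. R / 2 ^ k) \<longlonglongrightarrow> 0"
      by (rule LIMSEQ_divide_realpow_zero) simp
    then have ev: "\<forall>\<^sub>F k in sequentially. R / 2 ^ k < r0"
      using r0 by (simp add: order_tendsto_iff)
    have "(\<integral>\<^sup>+y\<in>cube 0 R. \<phi> y \<partial>lebesgue) \<le> ennreal (C * R powr (CARD('n) + \<beta>) * 0)"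
      by (rule tendsto_lowerbound[OF lim])
        (use ev in \<open>eventually_elim; auto simp: R_def intro!: refined\<close>, simp)
    then show ?thesis by (simp add: R_def)
  qed
  then have "AE y in lebesgue. \<phi> y * indicator (cube 0 (real (Suc N))) y = 0" for N
    by (subst (asm) nn_integral_0_iff_AE) auto
  then have "AE y in lebesgue. \<forall>N. \<phi> y * indicator (cube 0 (real (Suc N))) y = 0"
    by (subst AE_all_countable) blast
  then show ?thesis
  proof eventually_elim
    case (elim y)
    obtain N where "norm y \<le> real N"
      using real_arch_simple by blast
    then have "\<bar>y $ i\<bar> \<le> real (Suc N)" for i
      using component_le_norm_cart[of y i] by simp
    then have "y \<in> cube 0 (real (Suc N))"
      by (simp add: mem_cube_iff)
    with elim show ?case by (auto dest: spec[of _ N])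
  qed
qed

section \<open>Means and oscillation\<close>

lemma set_integrable_const_lmeasurable:
  "E \<in> lmeasurable \<Longrightarrow> (\<lambda>x. c :: real) absolutely_integrable_on E"
  by (auto simp: set_integrable_def fmeasurable_def less_top)

lemma set_integral_const_lmeasurable:
  "E \<in> lmeasurable \<Longrightarrow> (LINT x:E|lebesgue. (c :: real)) = measure lebesgue E * c"
  by (auto simp: set_integral_const fmeasurable_def)

lemma set_integral_eq_mean:
  assumes "0 < measure lebesgue E"
  shows "(LINT x:E|lebesgue. u x) = measure lebesgue E * mean E u"
  using assms by (simp add: mean_def)

lemma mean_le_iff:
  assumes "0 < measure lebesgue E"
  shows "mean E u \<le> b \<longleftrightarrow> (LINT x:E|lebesgue. u x) \<le> measure lebesgue E * b"
  using assms by (simp add: mean_def field_simps)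

lemma mean_abs_nonneg: "0 \<le> mean E (\<lambda>x. \<bar>u x\<bar>)"
  by (auto simp: mean_def set_lebesgue_integral_def intro!: mult_nonneg_nonneg integral_nonneg_AE)

lemma abs_mean_diff_le:
  assumes E: "E \<in> lmeasurable" "0 < measure lebesgue E" and u: "u absolutely_integrable_on E"
  shows "\<bar>mean E u - c\<bar> * measure lebesgue E \<le> (LINT x:E|lebesgue. \<bar>u x - c\<bar>)"
proof -
  have int: "(\<lambda>x. u x - c) absolutely_integrable_on E"
    using u set_integrable_const_lmeasurable[OF E(1)] by (rule set_integral_diff)
  have "measure lebesgue E * (mean E u - c) = (LINT x:E|lebesgue. u x) - (LINT x:E|lebesgue. c)"
    using E
    by (simp add: set_integral_eq_mean[OF E(2), of u] set_integral_const_lmeasurable algebra_simps)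
  also have "\<dots> = (LINT x:E|lebesgue. u x - c)"
    using u set_integrable_const_lmeasurable[OF E(1)] by (rule set_integral_diff(2)[symmetric])
  finally have "measure lebesgue E * \<bar>mean E u - c\<bar> = \<bar>LINT x:E|lebesgue. u x - c\<bar>"
    using E(2) by (metis abs_mult abs_of_pos)
  also have "\<dots> \<le> (LINT x:E|lebesgue. \<bar>u x - c\<bar>)"
    using set_integral_norm_bound[OF int] by simp
  finally show ?thesis by (simp add: mult.commute)
qed

text \<open>Both places where a pointwise estimate is passed to a mean use this: averaging over the second
variable in S2, and bounding the \<open>p\<close>-th power of the deviation.\<close>
lemma mean_within_AE_bound:
  assumes E: "E \<in> lmeasurable" "0 < measure lebesgue E" and u: "u absolutely_integrable_on E"
    and bound: "AE x\<in>E in lebesgue. \<bar>u x - c\<bar> \<le> B"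
  shows "\<bar>mean E u - c\<bar> \<le> B"
proof -
  have int: "(\<lambda>x. u x - c) absolutely_integrable_on E"
    using u set_integrable_const_lmeasurable[OF E(1)] by (rule set_integral_diff)
  have "\<bar>mean E u - c\<bar> * measure lebesgue E \<le> (LINT x:E|lebesgue. \<bar>u x - c\<bar>)"
    by (rule abs_mean_diff_le[OF E u])
  also have "\<dots> \<le> (LINT x:E|lebesgue. B)"
    using set_integrable_abs[OF int] set_integrable_const_lmeasurable[OF E(1)] bound
    by (rule set_integral_mono_AE)
  finally show ?thesis
    using E by (simp add: set_integral_const_lmeasurable mult.commute)
qed

text \<open>An elementary substitute for Jensen's inequality: for \<open>t > s\<close> it follows from
\<open>t / s \<le> (t / s) powr p\<close>.
Being linear in \<open>t powr p\<close>, it can be integrated directly.\<close>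
lemma le_add_powr:
  fixes t s p :: real
  assumes "0 \<le> t" "0 < s" "1 \<le> p"
  shows "t \<le> s + s powr (1 - p) * t powr p"
proof (cases "t \<le> s")
  case True
  then show ?thesis by (simp add: add_increasing2)
next
  case False
  then have "(t / s) powr 1 \<le> (t / s) powr p"
    using assms by (intro powr_mono) (auto simp: field_simps)
  then have "t \<le> s * (t / s) powr p"
    using assms False by (simp add: field_simps)
  also have "\<dots> = s powr (1 - p) * t powr p"
    using assms False by (simp add: powr_diff powr_divide)
  finally show ?thesis using assms by simp
qed

text \<open>Integrating \<open>le_add_powr\<close> with \<open>s\<close> equal to the bound on the \<open>L^p\<close> mean makes both summands
contribute \<open>s\<close>; hence the factor 2. The exponent \<open>p\<close> disappears from the argument here.\<close>
lemma L1_oscillation_le: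
  assumes E: "E \<in> lmeasurable" "0 < measure lebesgue E" and s: "0 < s" and p: "1 \<le> p"
    and osc: "abs_oscillation_le f E p s"
  shows "(LINT x:E|lebesgue. \<bar>f x - mean E (\<lambda>y. \<bar>f y\<bar>)\<bar>) \<le> 2 * s * measure lebesgue E"
proof -
  define h where "h x = \<bar>f x - mean E (\<lambda>y. \<bar>f y\<bar>)\<bar>" for x
  have f: "f absolutely_integrable_on E" and hp: "(\<lambda>x. h x powr p) absolutely_integrable_on E"
    and le: "mean E (\<lambda>x. h x powr p) powr (1 / p) \<le> s"
    using osc by (auto simp: abs_oscillation_le_def h_def)
  have h: "h absolutely_integrable_on E"
    unfolding h_def
    by (intro set_integrable_abs set_integral_diff f set_integrable_const_lmeasurable E)
  have h_nonneg: "0 \<le> h x" for x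
    by (simp add: h_def)
  have pos: "0 \<le> mean E (\<lambda>x. h x powr p)"
    using mean_abs_nonneg[of E "\<lambda>x. h x powr p"] by simp
  have "mean E (\<lambda>x. h x powr p) = (mean E (\<lambda>x. h x powr p) powr (1 / p)) powr p"
    using pos p by (simp add: powr_powr)
  also have "\<dots> \<le> s powr p"
    using le p by (intro powr_mono2) auto
  finally have mean_le: "(LINT x:E|lebesgue. h x powr p) \<le> measure lebesgue E * s powr p"
    using E by (simp add: mean_le_iff)
  have "(LINT x:E|lebesgue. h x) \<le> (LINT x:E|lebesgue. s + s powr (1 - p) * h x powr p)"
    using h hp s p E
    by (intro set_integral_mono set_integral_add set_integrable_mult_right
        set_integrable_const_lmeasurable le_add_powr) (simp_all add: h_nonneg)
  also have "\<dots> = measure lebesgue E * s + s powr (1 - p) * (LINT x:E|lebesgue. h x powr p)"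
    using hp E by (subst set_integral_add)
      (auto intro: set_integrable_const_lmeasurable simp: set_integral_const_lmeasurable)
  also have "\<dots> \<le> measure lebesgue E * s + s powr (1 - p) * (measure lebesgue E * s powr p)"
    using mean_le by (intro add_left_mono mult_left_mono) auto
  also have "\<dots> = 2 * s * measure lebesgue E"
    using s by (simp add: powr_diff)
  finally show ?thesis by (simp add: h_def)
qed

text \<open>The hypothesis controls \<open>f\<close> minus the mean of \<open>\<bar>f\<bar>\<close>, whereas the conclusion compares two means
of \<open>\<bar>f\<bar>\<close>. The gap closes because the mean \<open>m\<close> over \<open>F\<close> is nonnegative, so that
\<open>\<bar>\<bar>f\<bar> - m\<bar> \<le> \<bar>f - m\<bar>\<close>.\<close>
lemma abs_mean_diff_subset_le:
  assumes E: "E \<in> lmeasurable" "0 < measure lebesgue E" and F: "F \<in> lmeasurable" and "E \<subseteq> F"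
    and f: "f absolutely_integrable_on F"
    and osc: "(LINT x:F|lebesgue. \<bar>f x - mean F (\<lambda>y. \<bar>f y\<bar>)\<bar>) \<le> s * measure lebesgue F"
  shows "\<bar>mean E (\<lambda>y. \<bar>f y\<bar>) - mean F (\<lambda>y. \<bar>f y\<bar>)\<bar> * measure lebesgue E \<le> s * measure lebesgue F"
proof -
  define m where "m = mean F (\<lambda>y. \<bar>f y\<bar>)"
  have "0 \<le> m" by (simp add: m_def mean_abs_nonneg)
  have sub: "E \<in> sets lebesgue" using E by auto
  have fE: "f absolutely_integrable_on E"
    using f sub \<open>E \<subseteq> F\<close> by (rule set_integrable_subset)
  have intF: "(\<lambda>x. \<bar>f x - m\<bar>) absolutely_integrable_on F"
    by (intro set_integrable_abs set_integral_diff f set_integrable_const_lmeasurable F)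
  have intE: "(\<lambda>x. \<bar>f x - m\<bar>) absolutely_integrable_on E"
    using intF sub \<open>E \<subseteq> F\<close> by (rule set_integrable_subset)
  have "\<bar>mean E (\<lambda>y. \<bar>f y\<bar>) - m\<bar> * measure lebesgue E \<le> (LINT x:E|lebesgue. \<bar>\<bar>f x\<bar> - m\<bar>)"
    by (rule abs_mean_diff_le[OF E set_integrable_abs[OF fE]])
  also have "\<dots> \<le> (LINT x:E|lebesgue. \<bar>f x - m\<bar>)"
    using \<open>0 \<le> m\<close> intE fE E
    by (intro set_integral_mono set_integrable_abs set_integral_diff set_integrable_const_lmeasurable)
      auto
  also have "\<dots> \<le> (LINT x:F|lebesgue. \<bar>f x - m\<bar>)"
    using intE intF \<open>E \<subseteq> F\<close> unfolding set_lebesgue_integral_def set_integrable_def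
    by (intro integral_mono) (auto split: split_indicator)
  finally show ?thesis using osc by (simp add: m_def)
qed

text \<open>An open set is a countable union of compact boxes, on each of which \<open>f\<close> is integrable.\<close>
lemma locally_integrable_imp_borel_measurable:
  fixes \<Omega> :: "(real ^ 'n) set"
  assumes "open \<Omega>" "f \<in> locally_integrable \<Omega>"
  shows "f \<in> borel_measurable (lebesgue_on \<Omega>)"
proof -
  obtain \<D> :: "(real ^ 'n) set set" where "countable \<D>" and cbox: "\<And>X. X \<in> \<D> \<Longrightarrow> \<exists>a b. X = cbox a b"
    and union: "\<Union>\<D> = \<Omega>"
    using open_countable_Union_open_cbox[OF assms(1)] by metis
  show ?thesis
  proof (rule measurable_piecewise_restrict[OF \<open>countable \<D>\<close>])
    show "space (lebesgue_on \<Omega>) \<subseteq> \<Union> \<D>"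
      using union by simp
    fix X assume "X \<in> \<D>"
    then have X: "\<Omega> \<inter> X = X" "X \<in> sets lebesgue" "compact X"
      using cbox[of X] union by auto
    then show "X \<inter> space (lebesgue_on \<Omega>) \<in> sets (lebesgue_on \<Omega>)"
      using \<open>open \<Omega>\<close> by (auto simp: sets_restrict_space)
    have "f absolutely_integrable_on X"
      using assms(2) X by (auto simp: locally_integrable_def)
    then have "f \<in> borel_measurable (lebesgue_on X)"
      using X by (simp add: absolutely_integrable_measurable)
    then show "f \<in> borel_measurable (restrict_space (lebesgue_on \<Omega>) X)"
      using X \<open>open \<Omega>\<close> by (simp add: restrict_restrict_space)
  qed
qed

lemma absolutely_integrable_on_if_AE_bounded:
  fixes u :: "real ^ 'n \<Rightarrow> real"
  assumes E: "E \<in> lmeasurable" and u: "u \<in> borel_measurable (lebesgue_on E)"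
    and bound: "AE x\<in>E in lebesgue. \<bar>u x\<bar> \<le> B"
  shows "u absolutely_integrable_on E"
proof (rule set_integrable_bound)
  show "(\<lambda>x. B) absolutely_integrable_on E"
    using E by (rule set_integrable_const_lmeasurable)
  show "set_borel_measurable lebesgue E u"
    using u E by (simp add: set_borel_measurable_def borel_measurable_restrict_space_iff fmeasurableD)
qed (use bound in \<open>auto elim: eventually_mono\<close>)

text \<open>One admissible \<open>x\<close> already shows that \<open>\<bar>f\<bar>\<close> is essentially bounded, hence integrable. Averaging
the assumption over \<open>y\<close> then puts the mean of \<open>\<bar>f\<bar>\<close> within \<open>B\<close> of \<open>f x\<close> for almost every \<open>x\<close>.\<close>
lemma abs_oscillation_le_if_pairwise_bound:
  assumes E: "E \<in> lmeasurable" "0 < measure lebesgue E"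
    and f: "f \<in> borel_measurable (lebesgue_on E)" and p: "1 \<le> p" and B: "0 \<le> B"
    and pair: "AE x\<in>E in lebesgue. AE y\<in>E in lebesgue. \<bar>f x - \<bar>f y\<bar>\<bar> \<le> B"
  shows "abs_oscillation_le f E p B"
proof -
  define h where "h x = \<bar>f x - mean E (\<lambda>y. \<bar>f y\<bar>)\<bar>" for x
  have "\<exists>x\<in>E. AE y\<in>E in lebesgue. \<bar>f x - \<bar>f y\<bar>\<bar> \<le> B"
  proof (rule ccontr)
    assume "\<not> ?thesis"
    with pair have "AE x in lebesgue. x \<notin> E"
      by (auto elim: eventually_mono)
    then have "emeasure lebesgue E = 0"
      using E by (subst (asm) AE_iff_measurable[of E]) auto
    then show False using E(2) by (simp add: measure_def)
  qed
  then obtain x0 where "AE y\<in>E in lebesgue. \<bar>f x0 - \<bar>f y\<bar>\<bar> \<le> B" by blast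
  then have "AE y\<in>E in lebesgue. \<bar>f y\<bar> \<le> \<bar>f x0\<bar> + B"
    by (auto elim: eventually_mono)
  then have int: "f absolutely_integrable_on E"
    by (rule absolutely_integrable_on_if_AE_bounded[OF E(1) f])
  have "AE x\<in>E in lebesgue. h x \<le> B"
    using pair
  proof eventually_elim
    case (elim x)
    show ?case
    proof
      assume "x \<in> E"
      with elim have "AE y\<in>E in lebesgue. \<bar>\<bar>f y\<bar> - f x\<bar> \<le> B"
        by (simp add: abs_minus_commute)
      then have "\<bar>mean E (\<lambda>y. \<bar>f y\<bar>) - f x\<bar> \<le> B"
        by (rule mean_within_AE_bound[OF E set_integrable_abs[OF int]])
      then show "h x \<le> B" by (simp add: h_def abs_minus_commute)
    qed
  qed
  then have bound: "AE x\<in>E in lebesgue. \<bar>h x powr p\<bar> \<le> B powr p"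
  proof eventually_elim
    case (elim x)
    then show ?case using p by (auto intro!: powr_mono2 simp: h_def)
  qed
  have hp: "(\<lambda>x. h x powr p) absolutely_integrable_on E"
    using f unfolding h_def
    by (intro absolutely_integrable_on_if_AE_bounded[OF E(1) _ bound[unfolded h_def]]) measurable
  have "mean E (\<lambda>x. h x powr p) \<le> B powr p"
    using mean_within_AE_bound[OF E hp, of 0 "B powr p"] bound by simp
  then have "mean E (\<lambda>x. h x powr p) powr (1 / p) \<le> (B powr p) powr (1 / p)"
    using p mean_abs_nonneg[of E "\<lambda>x. h x powr p"] by (intro powr_mono2) auto
  also have "\<dots> = B"
    using p B by (simp add: powr_powr)
  finally show ?thesis
    using int hp by (simp add: abs_oscillation_le_def h_def)
qed

section \<open>Limits along halved radii\<close>

text \<open>Comparing a radius \<open>r\<close> with a larger \<open>\<rho>\<close> through \<open>\<rho>, \<rho> / 2, \<rho> / 4, \<dots>\<close>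
produces a geometric series of ratio \<open>2 powr (-\<beta>)\<close>. The error at \<open>\<rho>\<close> is therefore a constant times \<open>\<rho> powr \<beta>\<close>, uniformly in \<open>r\<close>; this gives
both the Cauchy property and the rate. Being explicit, the constant is the same for all families with the same \<open>K\<close>, in particular for the means
about all points of a domain.\<close>
lemma limit_of_halving_family:
  fixes m :: "real \<Rightarrow> real" and D :: ereal and \<beta> K :: real
  assumes \<beta>: "0 < \<beta>" and "0 \<le> K" and D: "0 < D"
    and step: "\<And>r \<rho>. 0 < r \<Longrightarrow> r \<le> \<rho> \<Longrightarrow> \<rho> \<le> 2 * r \<Longrightarrow> ereal \<rho> < D \<Longrightarrow>
      \<bar>m r - m \<rho>\<bar> \<le> K * \<rho> powr \<beta>"
  shows "\<exists>l. \<forall>\<rho>. 0 < \<rho> \<and> ereal \<rho> < D \<longrightarrow> \<bar>l - m \<rho>\<bar> \<le> K / (1 - 2 powr (-\<beta>)) * \<rho> powr \<beta>"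
proof -
  define q where "q = 2 powr (-\<beta>)"
  \<comment> \<open>The sum of the geometric series, characterised by \<open>K' = K + K' * q\<close>.\<close>
  define K' where "K' = K / (1 - q)"
  have q: "0 < q" "q < 1"
    using \<beta> powr_less_mono[of "-\<beta>" 0 2] by (auto simp: q_def)
  have K': "K' = K + K' * q" "0 \<le> K'"
    using q \<open>0 \<le> K\<close> by (auto simp: K'_def field_simps)
  moreover have "0 \<le> K' * q"
    using K'(2) q by simp
  ultimately have "K \<le> K'" by linarith
  have chain: "\<bar>m r - m \<rho>\<bar> \<le> K' * \<rho> powr \<beta>"
    if "0 < r" "r \<le> \<rho>" "\<rho> \<le> 2 * 2 ^ k * r" "ereal \<rho> < D" for r \<rho> k
    using that
  proof (induction k arbitrary: \<rho>)
    case 0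
    have "\<bar>m r - m \<rho>\<bar> \<le> K * \<rho> powr \<beta>"
      using 0 by (intro step) auto
    also have "\<dots> \<le> K' * \<rho> powr \<beta>"
      using \<open>K \<le> K'\<close> by (intro mult_right_mono) simp_all
    finally show ?case .
  next
    case (Suc k)
    have half: "ereal (\<rho> / 2) < D"
      using Suc.prems by (intro le_less_trans[of "ereal (\<rho> / 2)" "ereal \<rho>" D]) auto
    show ?case
    proof (cases "\<rho> \<le> 2 * r")
      case True
      have "\<bar>m r - m \<rho>\<bar> \<le> K * \<rho> powr \<beta>"
        using Suc.prems True by (intro step) auto
      also have "\<dots> \<le> K' * \<rho> powr \<beta>"
        using \<open>K \<le> K'\<close> by (intro mult_right_mono) simp_all
      finally show ?thesis .
    next
      case False
      have "\<bar>m r - m (\<rho> / 2)\<bar> \<le> K' * (\<rho> / 2) powr \<beta>"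
        using Suc.prems False half by (intro Suc.IH) auto
      moreover have "\<bar>m (\<rho> / 2) - m \<rho>\<bar> \<le> K * \<rho> powr \<beta>"
        using Suc.prems by (intro step) auto
      moreover have "(\<rho> / 2) powr \<beta> = q * \<rho> powr \<beta>"
        using Suc.prems by (simp add: q_def powr_divide powr_minus field_simps)
      ultimately have "\<bar>m r - m \<rho>\<bar> \<le> (K + K' * q) * \<rho> powr \<beta>"
        by (simp add: algebra_simps)
      then show ?thesis
        using K'(1) by simp
    qed
  qed
  have close: "\<bar>m r - m \<rho>\<bar> \<le> K' * \<rho> powr \<beta>" if "0 < r" "r \<le> \<rho>" "ereal \<rho> < D" for r \<rho>
  proof -
    obtain k where "\<rho> / r < 2 ^ k"
      using real_arch_pow[of 2 "\<rho> / r"] by auto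
    then have "\<rho> \<le> 2 * 2 ^ k * r"
      using that by (simp add: field_simps)
    then show ?thesis using that by (intro chain)
  qed
  obtain t where t: "0 < t" "ereal t < D"
    using D by (metis ereal_dense2 ereal_less(2))
  define X where "X n = m (t / 2 ^ n)" for n
  have small: "ereal (t / 2 ^ n) < D" "0 < t / 2 ^ n" "i \<le> n \<Longrightarrow> t / 2 ^ n \<le> t / 2 ^ i" for i n
    using t by (auto intro!: le_less_trans[of "ereal (t / 2 ^ n)" "ereal t" D] divide_left_mono
        simp: field_simps)
  have "(\<lambda>n. t / 2 ^ n) \<longlonglongrightarrow> 0"
    by (rule LIMSEQ_divide_realpow_zero) simp
  then have ev: "\<forall>\<^sub>F n in sequentially. t / 2 ^ n < \<rho>" if "0 < \<rho>" for \<rho>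
    using that by (simp add: order_tendsto_iff)
  have "(\<lambda>n. K' * (t / 2 ^ n) powr \<beta>) \<longlonglongrightarrow> K' * 0 powr \<beta>"
    using \<beta> small(2) \<open>(\<lambda>n. t / 2 ^ n) \<longlonglongrightarrow> 0\<close>
    by (intro tendsto_mult_left tendsto_powr') (auto simp: less_imp_le[OF small(2)])
  then have ev': "\<forall>\<^sub>F n in sequentially. K' * (t / 2 ^ n) powr \<beta> < e" if "0 < e" for e
    using that by (simp add: order_tendsto_iff)
  have "Cauchy X"
  proof (rule CauchyI')
    fix e :: real assume "0 < e"
    then obtain N where N: "\<And>n. n \<ge> N \<Longrightarrow> K' * (t / 2 ^ n) powr \<beta> < e"
      using ev' by (auto simp: eventually_sequentially)
    show "\<exists>N. \<forall>i\<ge>N. \<forall>n>i. dist (X i) (X n) < e"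
    proof (intro exI allI impI)
      fix i n assume "i \<ge> N" "n > i"
      then have "\<bar>X n - X i\<bar> \<le> K' * (t / 2 ^ i) powr \<beta>"
        unfolding X_def using small by (intro close) auto
      then show "dist (X i) (X n) < e"
        using N[OF \<open>i \<ge> N\<close>] by (simp add: dist_real_def)
    qed
  qed
  then obtain l where l: "X \<longlonglongrightarrow> l"
    using Cauchy_convergent convergent_def by blast
  have "\<bar>l - m \<rho>\<bar> \<le> K' * \<rho> powr \<beta>" if "0 < \<rho>" "ereal \<rho> < D" for \<rho>
  proof (rule tendsto_upperbound)
    show "(\<lambda>n. \<bar>X n - m \<rho>\<bar>) \<longlonglongrightarrow> \<bar>l - m \<rho>\<bar>"
      by (intro tendsto_intros l)
    show "\<forall>\<^sub>F n in sequentially. \<bar>X n - m \<rho>\<bar> \<le> K' * \<rho> powr \<beta>"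
      using ev[OF \<open>0 < \<rho>\<close>]
    proof eventually_elim
      case (elim n)
      then show ?case unfolding X_def using small that by (intro close) auto
    qed
  qed simp
  then show ?thesis unfolding K'_def q_def by blast
qed

section \<open>Hoelder functions\<close>

text \<open>The multiplied-out form with a nonnegative constant also covers \<open>x = y\<close>, where both sides are 0.\<close>
lemma holder_space_iff:
  "g \<in> holder_space \<Omega> \<beta> \<longleftrightarrow>
    (\<exists>H\<ge>0. \<forall>x\<in>\<Omega>. \<forall>y\<in>\<Omega>. \<bar>g x - g y\<bar> \<le> H * norm (x - y) powr \<beta>)"
proof
  assume "g \<in> holder_space \<Omega> \<beta>"
  then obtain H where H: "\<And>x y. x \<in> \<Omega> \<Longrightarrow> y \<in> \<Omega> \<Longrightarrow> x \<noteq> y \<Longrightarrow>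
      \<bar>g x - g y\<bar> / norm (x - y) powr \<beta> \<le> H"
    unfolding holder_space_def bdd_above_def by blast
  have "\<bar>g x - g y\<bar> \<le> max H 0 * norm (x - y) powr \<beta>" if "x \<in> \<Omega>" "y \<in> \<Omega>" for x y
  proof (cases "x = y")
    case False
    then have "\<bar>g x - g y\<bar> / norm (x - y) powr \<beta> \<le> max H 0"
      using H[OF that False] by simp
    then show ?thesis
      using False by (simp add: pos_divide_le_eq)
  qed simp
  then show "\<exists>H\<ge>0. \<forall>x\<in>\<Omega>. \<forall>y\<in>\<Omega>. \<bar>g x - g y\<bar> \<le> H * norm (x - y) powr \<beta>"
    by (intro exI[of _ "max H 0"]) auto
next
  assume "\<exists>H\<ge>0. \<forall>x\<in>\<Omega>. \<forall>y\<in>\<Omega>. \<bar>g x - g y\<bar> \<le> H * norm (x - y) powr \<beta>"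
  then obtain H where "\<And>x y. x \<in> \<Omega> \<Longrightarrow> y \<in> \<Omega> \<Longrightarrow> \<bar>g x - g y\<bar> \<le> H * norm (x - y) powr \<beta>"
    by blast
  then have "\<bar>g x - g y\<bar> / norm (x - y) powr \<beta> \<le> H" if "x \<in> \<Omega>" "y \<in> \<Omega>" "x \<noteq> y" for x y
    using that by (simp add: pos_divide_le_eq)
  then show "g \<in> holder_space \<Omega> \<beta>"
    unfolding holder_space_def bdd_above_def by blast
qed

lemma holder_imp_continuous_on:
  assumes g: "g \<in> holder_space \<Omega> \<beta>" and "0 < \<beta>"
  shows "continuous_on \<Omega> g"
proof -
  obtain H where H: "\<And>x y. x \<in> \<Omega> \<Longrightarrow> y \<in> \<Omega> \<Longrightarrow> \<bar>g x - g y\<bar> \<le> H * norm (x - y) powr \<beta>"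
    using g unfolding holder_space_iff by blast
  show ?thesis
    unfolding continuous_on_def
  proof
    fix x assume "x \<in> \<Omega>"
    have "((\<lambda>y. H * norm (y - x) powr \<beta>) \<longlongrightarrow> H * norm (x - x) powr \<beta>) (at x within \<Omega>)"
      using \<open>0 < \<beta>\<close> by (intro tendsto_intros tendsto_powr') auto
    then have lim: "((\<lambda>y. H * norm (y - x) powr \<beta>) \<longlongrightarrow> 0) (at x within \<Omega>)"
      by simp
    have "((\<lambda>y. g y - g x) \<longlongrightarrow> 0) (at x within \<Omega>)"
      by (rule Lim_null_comparison[OF _ lim])
        (use H \<open>x \<in> \<Omega>\<close> in \<open>auto simp: eventually_at_filter\<close>)
    then show "(g \<longlongrightarrow> g x) (at x within \<Omega>)"
      by (simp add: LIM_zero_iff)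
  qed
qed

lemma dist_le_ediam: "x \<in> S \<Longrightarrow> y \<in> S \<Longrightarrow> ereal (dist x y) \<le> ediam S"
  unfolding ediam_def by (rule SUP_upper2[of "(x, y)"]) auto

lemma ediam_pos_if_open:
  fixes \<Omega> :: "(real ^ 'n) set"
  assumes "open \<Omega>" "\<Omega> \<noteq> {}"
  shows "0 < ediam \<Omega>"
proof -
  obtain x where "x \<in> \<Omega>" using assms by blast
  have "\<not> \<Omega> \<subseteq> {x}"
    using assms(1) \<open>x \<in> \<Omega>\<close> not_open_singleton[of x] by (metis empty_iff subset_singletonD)
  then obtain y where "y \<in> \<Omega>" "y \<noteq> x" by blast
  then have "0 < ereal (dist x y)" by simp
  also have "\<dots> \<le> ediam \<Omega>" using \<open>x \<in> \<Omega>\<close> \<open>y \<in> \<Omega>\<close> by (rule dist_le_ediam)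
  finally show ?thesis .
qed

text \<open>Pairs at distance at least half the diameter exist only if \<open>\<Omega>\<close> is bounded. Then \<open>\<Omega>\<close> is
covered by finitely many balls of a quarter of the diameter as radius, so the local estimate makes \<open>g\<close> bounded, and for
such pairs boundedness of \<open>g\<close> is as good as a Hoelder estimate. The resulting constant depends on
\<open>g\<close> and \<open>\<Omega>\<close>.\<close>
lemma holder_space_if_holder_below_half_diameter:
  fixes \<Omega> :: "(real ^ 'n) set"
  assumes "0 < \<beta>" and "0 \<le> L" and diam: "0 < ediam \<Omega>"
    and near: "\<And>x y. x \<in> \<Omega> \<Longrightarrow> y \<in> \<Omega> \<Longrightarrow> ereal (2 * norm (x - y)) < ediam \<Omega> \<Longrightarrow>
      \<bar>g x - g y\<bar> \<le> L * norm (x - y) powr \<beta>"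
  shows "g \<in> holder_space \<Omega> \<beta>"
proof (cases "ediam \<Omega> = \<infinity>")
  case True
  then show ?thesis
    using near \<open>0 \<le> L\<close> by (auto simp: holder_space_iff)
next
  case False
  then obtain d where d: "ediam \<Omega> = ereal d" "0 < d"
    using diam by (cases "ediam \<Omega>") auto
  have "dist x y \<le> d" if "x \<in> \<Omega>" "y \<in> \<Omega>" for x y
    using dist_le_ediam[OF that] d by simp
  then have "compact (closure \<Omega>)"
    by (auto simp: bounded_two_points)
  then obtain Z where Z: "Z \<subseteq> \<Omega>" "finite Z" "closure \<Omega> \<subseteq> (\<Union>z\<in>Z. ball z (d / 4))"
  proof (rule compactE_image)
    show "closure \<Omega> \<subseteq> (\<Union>z\<in>\<Omega>. ball z (d / 4))"
    proof
      fix x assume "x \<in> closure \<Omega>"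
      then have "\<exists>z\<in>\<Omega>. dist z x < d / 4"
        using d(2) unfolding closure_approachable by (meson divide_pos_pos zero_less_numeral)
      then show "x \<in> (\<Union>z\<in>\<Omega>. ball z (d / 4))" by auto
    qed
  qed auto
  define M where "M = (\<Sum>z\<in>Z. \<bar>g z\<bar>) + L * (d / 4) powr \<beta>"
  have M: "\<bar>g x\<bar> \<le> M" if "x \<in> \<Omega>" for x
  proof -
    have "x \<in> closure \<Omega>"
      using that closure_subset by blast
    then obtain z where z: "z \<in> Z" "norm (x - z) < d / 4"
      using Z(3) by (auto simp: dist_norm norm_minus_commute)
    have "\<bar>g x - g z\<bar> \<le> L * norm (x - z) powr \<beta>"
      using that z Z d by (intro near) auto
    also have "\<dots> \<le> L * (d / 4) powr \<beta>"
      using z \<open>0 < \<beta>\<close> \<open>0 \<le> L\<close> by (intro mult_left_mono powr_mono2) auto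
    finally have "\<bar>g x\<bar> \<le> \<bar>g z\<bar> + L * (d / 4) powr \<beta>" by linarith
    moreover have "\<bar>g z\<bar> \<le> (\<Sum>z\<in>Z. \<bar>g z\<bar>)"
      using z Z by (intro member_le_sum) auto
    ultimately show ?thesis by (simp add: M_def)
  qed
  have "0 \<le> M"
    using \<open>0 \<le> L\<close> by (simp add: M_def sum_nonneg)
  define H where "H = 2 * M / (d / 2) powr \<beta>"
  have "0 \<le> H" using \<open>0 \<le> M\<close> by (simp add: H_def)
  have "\<bar>g x - g y\<bar> \<le> (L + H) * norm (x - y) powr \<beta>" if xy: "x \<in> \<Omega>" "y \<in> \<Omega>" for x y
  proof (cases "2 * norm (x - y) < d")
    case True
    then have "\<bar>g x - g y\<bar> \<le> L * norm (x - y) powr \<beta>"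
      using xy d by (intro near) auto
    also have "\<dots> \<le> (L + H) * norm (x - y) powr \<beta>"
      using \<open>0 \<le> H\<close> by (intro mult_right_mono) auto
    finally show ?thesis .
  next
    case False
    have "\<bar>g x - g y\<bar> \<le> 2 * M"
      using M[OF xy(1)] M[OF xy(2)] by linarith
    also have "\<dots> = H * (d / 2) powr \<beta>"
      using d by (simp add: H_def)
    also have "\<dots> \<le> H * norm (x - y) powr \<beta>"
      using False d \<open>0 < \<beta>\<close> \<open>0 \<le> H\<close> by (intro mult_left_mono powr_mono2) auto
    also have "\<dots> \<le> (L + H) * norm (x - y) powr \<beta>"
      using \<open>0 \<le> L\<close> by (intro mult_right_mono) auto
    finally show ?thesis .
  qed
  then show ?thesis
    unfolding holder_space_iff using \<open>0 \<le> L\<close> \<open>0 \<le> H\<close> by (intro exI[of _ "L + H"]) auto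
qed

section \<open>From oscillation bounds to a Hoelder representative\<close>

text \<open>The setting reached from S3 after the reduction to \<open>p = 1\<close>. The dimension is a parameter because
the constants below depend on the type \<open>'n\<close> only through it.\<close>
locale campanato_abs =
  fixes \<Omega> :: "(real ^ 'n) set" and f :: "real ^ 'n \<Rightarrow> real" and A \<beta> s :: real
    and n :: nat
  assumes n_def: "n = CARD('n)" and open_domain: "open \<Omega>" and nonempty: "\<Omega> \<noteq> {}"
    and A: "0 < A" and \<beta>: "0 < \<beta>" and s: "0 \<le> s"
    and density: "\<And>x \<rho>. x \<in> \<Omega> \<Longrightarrow> 0 < \<rho> \<Longrightarrow> ereal \<rho> < ediam \<Omega> \<Longrightarrow>
      A * \<rho> ^ CARD('n) \<le> measure lebesgue (cube x \<rho> \<inter> \<Omega>)"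
    and measurable: "f \<in> borel_measurable (lebesgue_on \<Omega>)"
    and integrable: "\<And>x \<rho>. x \<in> \<Omega> \<Longrightarrow> 0 < \<rho> \<Longrightarrow> ereal \<rho> < ediam \<Omega> \<Longrightarrow>
      f absolutely_integrable_on (cube x \<rho> \<inter> \<Omega>)"
    and oscillation: "\<And>x \<rho>. x \<in> \<Omega> \<Longrightarrow> 0 < \<rho> \<Longrightarrow> ereal \<rho> < ediam \<Omega> \<Longrightarrow>
      (LINT y:cube x \<rho> \<inter> \<Omega>|lebesgue. \<bar>f y - mean (cube x \<rho> \<inter> \<Omega>) (\<lambda>y. \<bar>f y\<bar>)\<bar>)
        \<le> s * \<rho> powr \<beta> * measure lebesgue (cube x \<rho> \<inter> \<Omega>)"
begin

definition cube_mean :: "real ^ 'n \<Rightarrow> real \<Rightarrow> real" where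
  "cube_mean x \<rho> = mean (cube x \<rho> \<inter> \<Omega>) (\<lambda>y. \<bar>f y\<bar>)"

definition step_const :: real where
  "step_const = s * 4 ^ n / A"

definition limit_const :: real where
  "limit_const = step_const / (1 - 2 powr (-\<beta>))"

lemma step_const_nonneg: "0 \<le> step_const"
  using s A by (simp add: step_const_def)

lemma limit_const_nonneg: "0 \<le> limit_const"
  using step_const_nonneg \<beta> powr_less_mono[of "-\<beta>" 0 2] by (simp add: limit_const_def)

lemma measure_pos:
  assumes "x \<in> \<Omega>" "0 < \<rho>" "ereal \<rho> < ediam \<Omega>"
  shows "0 < measure lebesgue (cube x \<rho> \<inter> \<Omega>)"
  using density[OF assms] A assms by (meson less_le_trans mult_pos_pos zero_less_power)

text \<open>The lower density bound for \<open>\<Omega>\<close> makes the constant uniform: passing from the larger cube to the smaller one costs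
the ratio of their intersections with \<open>\<Omega>\<close>, at most \<open>(2 \<rho>) ^ n / (A r ^ n) \<le> 4 ^ n / A\<close> because
\<open>\<rho> \<le> 2 r\<close>. It serves concentric cubes (existence of the limit) and cubes with different centres
(Hoelder continuity of the limit).\<close>
lemma cube_mean_diff_le:
  assumes x: "x \<in> \<Omega>" and y: "y \<in> \<Omega>" and r: "0 < r" "r \<le> \<rho>" "\<rho> \<le> 2 * r" "ereal \<rho> < ediam \<Omega>"
    and sub: "cube y r \<subseteq> cube x \<rho>"
  shows "\<bar>cube_mean y r - cube_mean x \<rho>\<bar> \<le> step_const * \<rho> powr \<beta>"
proof -
  let ?E = "cube y r \<inter> \<Omega>" and ?F = "cube x \<rho> \<inter> \<Omega>"
  have r': "ereal r < ediam \<Omega>" "0 < \<rho>"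
    using r by (auto intro: le_less_trans[of "ereal r" "ereal \<rho>"])
  have "\<bar>cube_mean y r - cube_mean x \<rho>\<bar> * (A * r ^ CARD('n))
      \<le> \<bar>cube_mean y r - cube_mean x \<rho>\<bar> * measure lebesgue ?E"
    using density[OF y r(1) r'(1)] by (rule mult_left_mono) simp
  also have "\<dots> \<le> s * \<rho> powr \<beta> * measure lebesgue ?F"
    unfolding cube_mean_def using sub r r' x y open_domain
    by (intro abs_mean_diff_subset_le lmeasurable_cube_Int_open measure_pos integrable oscillation)
      auto
  also have "\<dots> \<le> s * \<rho> powr \<beta> * (4 * r) ^ CARD('n)"
  proof (rule mult_left_mono)
    have "measure lebesgue ?F \<le> (2 * \<rho>) ^ CARD('n)"
      using r' by (intro measure_cube_Int_le open_domain) auto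
    also have "\<dots> \<le> (4 * r) ^ CARD('n)"
      using r r' by (intro power_mono) auto
    finally show "measure lebesgue ?F \<le> (4 * r) ^ CARD('n)" .
  qed (use s in simp)
  also have "\<dots> = step_const * \<rho> powr \<beta> * (A * r ^ CARD('n))"
    using A by (simp add: step_const_def power_mult_distrib flip: n_def)
  finally show ?thesis
    using A r by (simp add: mult_le_cancel_right)
qed

lemma cube_mean_limit:
  assumes x: "x \<in> \<Omega>"
  shows "\<exists>l. \<forall>\<rho>. 0 < \<rho> \<and> ereal \<rho> < ediam \<Omega> \<longrightarrow> \<bar>l - cube_mean x \<rho>\<bar> \<le> limit_const * \<rho> powr \<beta>"
  unfolding limit_const_def
proof (rule limit_of_halving_family[OF \<beta> step_const_nonneg])
  show "0 < ediam \<Omega>"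
    by (rule ediam_pos_if_open[OF open_domain nonempty])
  show "\<bar>cube_mean x r - cube_mean x \<rho>\<bar> \<le> step_const * \<rho> powr \<beta>"
    if "0 < r" "r \<le> \<rho>" "\<rho> \<le> 2 * r" "ereal \<rho> < ediam \<Omega>" for r \<rho>
    using that by (intro cube_mean_diff_le x cube_subset_cube) auto
qed

definition limit_mean :: "real ^ 'n \<Rightarrow> real" where
  "limit_mean x = (SOME l. \<forall>\<rho>. 0 < \<rho> \<and> ereal \<rho> < ediam \<Omega> \<longrightarrow>
     \<bar>l - cube_mean x \<rho>\<bar> \<le> limit_const * \<rho> powr \<beta>)"

lemma limit_mean_close:
  assumes "x \<in> \<Omega>" "0 < \<rho>" "ereal \<rho> < ediam \<Omega>"
  shows "\<bar>limit_mean x - cube_mean x \<rho>\<bar> \<le> limit_const * \<rho> powr \<beta>"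
  using someI_ex[OF cube_mean_limit[OF assms(1)]] assms(2,3) unfolding limit_mean_def by blast

lemma radius_below_ediam: obtains t where "0 < t" "ereal t < ediam \<Omega>"
  using ediam_pos_if_open[OF open_domain nonempty] by (metis ereal_dense2 ereal_less(2))

lemma limit_mean_nonneg:
  assumes x: "x \<in> \<Omega>"
  shows "0 \<le> limit_mean x"
proof -
  obtain t where t: "0 < t" "ereal t < ediam \<Omega>"
    by (rule radius_below_ediam)
  have "((\<lambda>\<rho>. - (limit_const * \<rho> powr \<beta>)) \<longlongrightarrow> - (limit_const * 0 powr \<beta>)) (at_right 0)"
    using \<beta> by (intro tendsto_intros tendsto_powr') (auto simp: eventually_at_filter)
  then have lim: "((\<lambda>\<rho>. - (limit_const * \<rho> powr \<beta>)) \<longlongrightarrow> 0) (at_right 0)"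
    by simp
  show ?thesis
  proof (rule tendsto_upperbound[OF lim])
    have "\<forall>\<^sub>F \<rho> in at_right 0. \<rho> \<in> {0<..<t}"
      using t(1) by (rule eventually_at_right_real)
    then show "\<forall>\<^sub>F \<rho> in at_right 0. - (limit_const * \<rho> powr \<beta>) \<le> limit_mean x"
    proof eventually_elim
      case (elim \<rho>)
      then have "ereal \<rho> < ediam \<Omega>"
        using t by (auto intro: less_trans[of "ereal \<rho>" "ereal t"])
      moreover have "0 \<le> cube_mean x \<rho>"
        unfolding cube_mean_def by (rule mean_abs_nonneg)
      ultimately show ?case
        using limit_mean_close[OF x, of \<rho>] elim by auto
    qed
  qed simp
qed

text \<open>For \<open>d = norm (x - y)\<close> the cube of radius \<open>d\<close> about \<open>y\<close> lies in the cube of radius \<open>2 d\<close> about \<open>x\<close>;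
hence the passage through the means over these two cubes, and the restriction to \<open>2 d\<close> below the
diameter, which \<open>holder_space_if_holder_below_half_diameter\<close> removes.\<close>
lemma limit_mean_holder: "limit_mean \<in> holder_space \<Omega> \<beta>"
proof (rule holder_space_if_holder_below_half_diameter[OF \<beta>])
  define L where "L = (2 * limit_const + step_const) * 2 powr \<beta>"
  show "0 \<le> L"
    using limit_const_nonneg step_const_nonneg by (simp add: L_def)
  show "0 < ediam \<Omega>"
    by (rule ediam_pos_if_open[OF open_domain nonempty])
  fix x y assume xy: "x \<in> \<Omega>" "y \<in> \<Omega>" and less: "ereal (2 * norm (x - y)) < ediam \<Omega>"
  define d where "d = norm (x - y)"
  show "\<bar>limit_mean x - limit_mean y\<bar> \<le> L * norm (x - y) powr \<beta>"
  proof (cases "x = y")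
    case False
    then have d: "0 < d" by (simp add: d_def)
    have d2: "ereal (2 * d) < ediam \<Omega>" "ereal d < ediam \<Omega>"
      using less d by (auto simp: d_def intro: le_less_trans[OF _ less])
    have "\<bar>limit_mean x - cube_mean x (2 * d)\<bar> \<le> limit_const * (2 * d) powr \<beta>"
      using xy d d2 by (intro limit_mean_close) auto
    moreover have "\<bar>limit_mean y - cube_mean y d\<bar> \<le> limit_const * d powr \<beta>"
      using xy d d2 by (intro limit_mean_close) auto
    moreover have "limit_const * d powr \<beta> \<le> limit_const * (2 * d) powr \<beta>"
      using d \<beta> limit_const_nonneg by (intro mult_left_mono powr_mono2) auto
    moreover have "\<bar>cube_mean y d - cube_mean x (2 * d)\<bar> \<le> step_const * (2 * d) powr \<beta>"
    proof (rule cube_mean_diff_le[OF xy])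
      show "cube y d \<subseteq> cube x (2 * d)"
      proof (rule cube_subset_cube)
        show "\<bar>y $ i - x $ i\<bar> + d \<le> 2 * d" for i
          using component_le_norm_cart[of "y - x" i] by (simp add: d_def norm_minus_commute)
      qed
    qed (use d d2 in auto)
    ultimately have "\<bar>limit_mean x - limit_mean y\<bar> \<le> (2 * limit_const + step_const) * (2 * d) powr \<beta>"
      by (simp add: algebra_simps)
    also have "\<dots> = L * norm (x - y) powr \<beta>"
      by (simp add: L_def d_def powr_mult)
    finally show ?thesis .
  qed simp
qed

text \<open>On a small cube about \<open>x\<close>, \<open>f\<close> is close in \<open>L^1\<close> to its mean by the oscillation bound, the mean is
close to \<open>limit_mean x\<close>, and the latter to \<open>limit_mean y\<close> by Hoelder continuity. All three errors
are of order \<open>\<rho> powr \<beta>\<close> times the volume, so \<open>AE_zero_if_small_cube_integrals\<close> applies to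
\<open>\<bar>f - limit_mean\<bar>\<close> on \<open>\<Omega>\<close>.\<close>
lemma AE_eq_limit_mean: "AE x\<in>\<Omega> in lebesgue. f x = limit_mean x"
proof -
  define \<phi> where "\<phi> y = ennreal (indicator \<Omega> y * \<bar>f y - limit_mean y\<bar>)" for y
  obtain H where H: "0 \<le> H" "\<And>x y. x \<in> \<Omega> \<Longrightarrow> y \<in> \<Omega> \<Longrightarrow>
      \<bar>limit_mean x - limit_mean y\<bar> \<le> H * norm (x - y) powr \<beta>"
    using limit_mean_holder unfolding holder_space_iff by blast
  obtain t where t: "0 < t" "ereal t < ediam \<Omega>"
    by (rule radius_below_ediam)
  define c where "c = limit_const + H * real n powr \<beta>"
  define C where "C = (s + c) * 2 powr \<beta> * 4 ^ n"
  have "0 \<le> c"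
    using limit_const_nonneg H by (simp add: c_def)
  have "AE y in lebesgue. \<phi> y = 0"
  proof (rule AE_zero_if_small_cube_integrals)
    have "limit_mean \<in> borel_measurable (lebesgue_on \<Omega>)"
      using open_domain holder_imp_continuous_on[OF limit_mean_holder \<beta>]
      by (intro continuous_imp_measurable_on_sets_lebesgue) auto
    then have "(\<lambda>y. \<bar>f y - limit_mean y\<bar>) \<in> borel_measurable (lebesgue_on \<Omega>)"
      using measurable by measurable
    then have "(\<lambda>y. indicator \<Omega> y * \<bar>f y - limit_mean y\<bar>) \<in> borel_measurable lebesgue"
      using open_domain by (simp add: borel_measurable_restrict_space_iff)
    then show "\<phi> \<in> borel_measurable lebesgue"
      unfolding \<phi>_def by measurable
    show "0 \<le> C" using s \<open>0 \<le> c\<close> by (simp add: C_def)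
    show "0 < \<beta>" "0 < t / 2" using \<beta> t by auto
    fix z r assume r: "0 < r" "r < t / 2"
    show "(\<integral>\<^sup>+y\<in>cube z r. \<phi> y \<partial>lebesgue) \<le> ennreal (C * r powr (CARD('n) + \<beta>))"
    proof (cases "cube z r \<inter> \<Omega> = {}")
      case True
      then have "\<phi> y * indicator (cube z r) y = 0" for y
        by (auto simp: \<phi>_def indicator_def)
      then have "(\<integral>\<^sup>+y\<in>cube z r. \<phi> y \<partial>lebesgue) = 0"
        by (simp only: nn_integral_0_iff_AE nn_integral_const) simp
      then show ?thesis by simp
    next
      case False
      \<comment> \<open>The cube may be centred outside \<open>\<Omega>\<close>; doubling its radius allows a centre in \<open>\<Omega>\<close>.\<close>
      then obtain x where x: "x \<in> \<Omega>" "x \<in> cube z r" by blast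
      define \<rho> where "\<rho> = 2 * r"
      define F where "F = cube x \<rho> \<inter> \<Omega>"
      have \<rho>: "0 < \<rho>" "ereal \<rho> < ediam \<Omega>"
        using r t by (auto simp: \<rho>_def intro: less_trans[of _ "ereal t"])
      have F: "F \<in> lmeasurable"
        unfolding F_def by (rule lmeasurable_cube_Int_open[OF open_domain])
      have "cube z r \<subseteq> cube x \<rho>"
        using x(2) by (intro cube_subset_cube) (simp add: mem_cube_iff \<rho>_def abs_minus_commute)
      then have sub: "cube z r \<inter> \<Omega> \<subseteq> F"
        by (auto simp: F_def)
      let ?h = "\<lambda>y. \<bar>f y - cube_mean x \<rho>\<bar> + c * \<rho> powr \<beta>"
      have h: "?h absolutely_integrable_on F"
        using integrable[OF x(1) \<rho>] F
        by (intro set_integral_add set_integrable_abs set_integral_diff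
            set_integrable_const_lmeasurable) (auto simp: F_def)
      have le: "\<bar>f y - limit_mean y\<bar> \<le> ?h y" if y: "y \<in> F" for y
      proof -
        have y': "y \<in> \<Omega>" "y \<in> cube x \<rho>"
          using y by (auto simp: F_def)
        have "\<bar>limit_mean x - limit_mean y\<bar> \<le> H * norm (x - y) powr \<beta>"
          by (rule H(2)[OF x(1) y'(1)])
        also have "\<dots> \<le> H * (real n * \<rho>) powr \<beta>"
          using norm_diff_le_of_mem_cube[OF y'(2)] H(1) \<beta>
          by (intro mult_left_mono powr_mono2) (auto simp: n_def norm_minus_commute)
        also have "\<dots> = H * real n powr \<beta> * \<rho> powr \<beta>"
          using \<rho> by (simp add: powr_mult)
        finally show ?thesis
          using limit_mean_close[OF x(1) \<rho>] by (simp add: c_def algebra_simps)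
      qed
      have "(\<integral>\<^sup>+y\<in>cube z r. \<phi> y \<partial>lebesgue) \<le> (\<integral>\<^sup>+y\<in>F. ennreal (?h y) \<partial>lebesgue)"
        using sub le by (intro nn_integral_mono) (auto simp: \<phi>_def indicator_def intro!: ennreal_leI)
      also have "\<dots> = (\<integral>\<^sup>+y. ennreal (indicator F y *\<^sub>R ?h y) \<partial>lebesgue)"
        by (intro nn_integral_cong) (simp add: indicator_def)
      also have "\<dots> = ennreal (LINT y:F|lebesgue. ?h y)"
        using h \<open>0 \<le> c\<close> unfolding set_integrable_def set_lebesgue_integral_def
        by (intro nn_integral_eq_integral) auto
      also have "(LINT y:F|lebesgue. ?h y) \<le> C * r powr (CARD('n) + \<beta>)"
      proof -
        have "(LINT y:F|lebesgue. ?h y)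
            = (LINT y:F|lebesgue. \<bar>f y - cube_mean x \<rho>\<bar>) + (LINT y:F|lebesgue. c * \<rho> powr \<beta>)"
          using integrable[OF x(1) \<rho>] F
          by (intro set_integral_add set_integrable_abs set_integral_diff
              set_integrable_const_lmeasurable) (auto simp: F_def)
        also have "\<dots> \<le> (s + c) * \<rho> powr \<beta> * measure lebesgue F"
          using oscillation[OF x(1) \<rho>] F
          by (simp add: set_integral_const_lmeasurable F_def cube_mean_def algebra_simps)
        also have "\<dots> \<le> (s + c) * \<rho> powr \<beta> * (2 * \<rho>) ^ n"
          unfolding F_def n_def using s \<open>0 \<le> c\<close> \<rho>
          by (intro mult_left_mono measure_cube_Int_le open_domain) auto
        also have "\<dots> = C * r powr (CARD('n) + \<beta>)"
          using r by (simp add: C_def \<rho>_def n_def powr_mult powr_add powr_realpow power_mult_distrib)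
        finally show ?thesis .
      qed
      finally show ?thesis by (simp add: ennreal_leI)
    qed
  qed
  then show ?thesis
    by (auto simp: \<phi>_def elim!: eventually_mono)
qed

end

section \<open>The equivalence\<close>

theorem theorem4p1:
  fixes \<Omega> :: "(real ^ 'n) set" and f :: "real ^ 'n \<Rightarrow> real" and A p \<beta> :: real
  assumes "open \<Omega>" and "connected \<Omega>" and "\<Omega> \<noteq> {}"
    and "A > 0"
    and "\<And>x\<^sub>0 \<rho>. x\<^sub>0 \<in> \<Omega> \<Longrightarrow> 0 < \<rho> \<Longrightarrow> ereal \<rho> < ediam \<Omega> \<Longrightarrow>
           measure lebesgue (cube x\<^sub>0 \<rho> \<inter> \<Omega>) \<ge> A * \<rho> ^ CARD('n)"
    and "1 \<le> p" and "0 < \<beta>" and "\<beta> \<le> 1"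
    and "f \<in> locally_integrable \<Omega>"
  defines "S1 \<equiv> \<exists>g \<in> holder_space \<Omega> \<beta>. (\<forall>x\<in>\<Omega>. g x \<ge> 0) \<and> (AE x in lebesgue_on \<Omega>. f x = g x)"
    and "S2 \<equiv> \<exists>C\<^sub>1::real. AE x in lebesgue_on \<Omega>. AE y in lebesgue_on \<Omega>.
           \<bar>f x - \<bar>f y\<bar>\<bar> \<le> C\<^sub>1 * norm (x - y) powr \<beta>"
    and "S3 \<equiv> \<exists>C\<^sub>2::real. \<forall>x\<^sub>0\<in>\<Omega>. \<forall>\<rho>. 0 < \<rho> \<and> ereal \<rho> < ediam \<Omega> \<longrightarrow>
           abs_oscillation_le f (cube x\<^sub>0 \<rho> \<inter> \<Omega>) p (C\<^sub>2 * \<rho> powr \<beta>)"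
  shows "(S1 \<longleftrightarrow> S2) \<and> (S2 \<longleftrightarrow> S3)"
proof -
  note \<open>open \<Omega>\<close>[simp]
  have AE_on: "(AE x in lebesgue_on \<Omega>. P x) \<longleftrightarrow> (AE x\<in>\<Omega> in lebesgue. P x)" for P
    by (rule AE_restrict_space_iff) simp
  have f: "f \<in> borel_measurable (lebesgue_on \<Omega>)"
    by (rule locally_integrable_imp_borel_measurable) fact+
  have E: "cube x \<rho> \<inter> \<Omega> \<in> lmeasurable" for x \<rho>
    by (rule lmeasurable_cube_Int_open) fact
  have pos: "0 < measure lebesgue (cube x \<rho> \<inter> \<Omega>)"
    if "x \<in> \<Omega>" "0 < \<rho>" "ereal \<rho> < ediam \<Omega>" for x \<rho>
    using assms(5)[OF that] \<open>A > 0\<close> \<open>0 < \<rho>\<close> by (meson less_le_trans mult_pos_pos zero_less_power)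
  have "S1 \<Longrightarrow> S2"
  proof -
    assume S1
    then obtain g where "g \<in> holder_space \<Omega> \<beta>" and g: "\<forall>x\<in>\<Omega>. 0 \<le> g x" "AE x\<in>\<Omega> in lebesgue. f x = g x"
      unfolding S1_def AE_on by auto
    then obtain H where H: "\<And>x y. x \<in> \<Omega> \<Longrightarrow> y \<in> \<Omega> \<Longrightarrow> \<bar>g x - g y\<bar> \<le> H * norm (x - y) powr \<beta>"
      unfolding holder_space_iff by blast
    have "AE x\<in>\<Omega> in lebesgue. AE y\<in>\<Omega> in lebesgue. \<bar>f x - \<bar>f y\<bar>\<bar> \<le> H * norm (x - y) powr \<beta>"
      using g(2)
    proof eventually_elim
      case (elim x)
      show ?case
      proof
        assume x: "x \<in> \<Omega>"
        show "AE y\<in>\<Omega> in lebesgue. \<bar>f x - \<bar>f y\<bar>\<bar> \<le> H * norm (x - y) powr \<beta>"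
          using g(2)
        proof eventually_elim
          case (elim y)
          then show ?case
            using \<open>x \<in> \<Omega> \<longrightarrow> f x = g x\<close> x g(1) H by auto
        qed
      qed
    qed
    then show S2
      unfolding S2_def AE_on by blast
  qed
  moreover have "S2 \<Longrightarrow> S3"
  proof -
    assume S2
    then obtain C where C: "AE x\<in>\<Omega> in lebesgue. AE y\<in>\<Omega> in lebesgue.
        \<bar>f x - \<bar>f y\<bar>\<bar> \<le> C * norm (x - y) powr \<beta>"
      unfolding S2_def AE_on by blast
    define n where "n = CARD('n)"
    have "abs_oscillation_le f (cube x0 \<rho> \<inter> \<Omega>) p (\<bar>C\<bar> * (2 * n) powr \<beta> * \<rho> powr \<beta>)"
      if "x0 \<in> \<Omega>" "0 < \<rho>" "ereal \<rho> < ediam \<Omega>" for x0 \<rho>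
    proof (rule abs_oscillation_le_if_pairwise_bound[OF E pos[OF that] _ \<open>1 \<le> p\<close>])
      let ?E = "cube x0 \<rho> \<inter> \<Omega>"
      show "f \<in> borel_measurable (lebesgue_on ?E)"
        by (rule measurable_restrict_mono[OF f]) auto
      have bound: "C * norm (x - y) powr \<beta> \<le> \<bar>C\<bar> * (2 * n) powr \<beta> * \<rho> powr \<beta>"
        if "x \<in> ?E" "y \<in> ?E" for x y
      proof -
        have "C * norm (x - y) powr \<beta> \<le> \<bar>C\<bar> * norm (x - y) powr \<beta>"
          by (intro mult_right_mono) auto
        also have "\<dots> \<le> \<bar>C\<bar> * (2 * n * \<rho>) powr \<beta>"
          using norm_diff_le_of_mem_cube2[of x x0 \<rho> y] that \<open>0 < \<beta>\<close>
          by (intro mult_left_mono powr_mono2) (auto simp: n_def)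
        finally show ?thesis
          using \<open>0 < \<rho>\<close> by (simp add: powr_mult)
      qed
      show "AE x\<in>?E in lebesgue. AE y\<in>?E in lebesgue.
          \<bar>f x - \<bar>f y\<bar>\<bar> \<le> \<bar>C\<bar> * (2 * n) powr \<beta> * \<rho> powr \<beta>"
        using C
      proof eventually_elim
        case (elim x)
        show ?case
        proof
          assume x: "x \<in> ?E"
          with elim have "AE y\<in>\<Omega> in lebesgue. \<bar>f x - \<bar>f y\<bar>\<bar> \<le> C * norm (x - y) powr \<beta>"
            by simp
          then show "AE y\<in>?E in lebesgue. \<bar>f x - \<bar>f y\<bar>\<bar> \<le> \<bar>C\<bar> * (2 * n) powr \<beta> * \<rho> powr \<beta>"
          proof eventually_elim
            case (elim y)
            then show ?case using bound[OF x, of y] by auto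
          qed
        qed
      qed
    qed simp
    then show S3
      unfolding S3_def by blast
  qed
  moreover have "S3 \<Longrightarrow> S1"
  proof -
    assume S3
    then obtain C where C: "\<And>x \<rho>. x \<in> \<Omega> \<Longrightarrow> 0 < \<rho> \<Longrightarrow> ereal \<rho> < ediam \<Omega> \<Longrightarrow>
        abs_oscillation_le f (cube x \<rho> \<inter> \<Omega>) p (C * \<rho> powr \<beta>)"
      unfolding S3_def by blast
    \<comment> \<open>The constant must be positive, since \<open>L1_oscillation_le\<close> divides by the bound.\<close>
    define s where "s = max C 1"
    have osc: "abs_oscillation_le f (cube x \<rho> \<inter> \<Omega>) p (s * \<rho> powr \<beta>)"
      if "x \<in> \<Omega>" "0 < \<rho>" "ereal \<rho> < ediam \<Omega>" for x \<rho>
    proof -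
      have "C * \<rho> powr \<beta> \<le> s * \<rho> powr \<beta>"
        by (intro mult_right_mono) (auto simp: s_def)
      then show ?thesis
        using C[OF that] by (auto simp: abs_oscillation_le_def)
    qed
    interpret campanato_abs \<Omega> f A  \<beta> "2 * s" "CARD('n)"
    proof
      fix x \<rho> assume x: "x \<in> \<Omega>" "0 < \<rho>" "ereal \<rho> < ediam \<Omega>"
      show "f absolutely_integrable_on cube x \<rho> \<inter> \<Omega>"
        using osc[OF x] by (simp add: abs_oscillation_le_def)
      have "0 < s * \<rho> powr \<beta>"
        using x(2) by (simp add: s_def)
      from L1_oscillation_le[OF E pos[OF x] this \<open>1 \<le> p\<close> osc[OF x]]
      show "(LINT y:cube x \<rho> \<inter> \<Omega>|lebesgue. \<bar>f y - mean (cube x \<rho> \<inter> \<Omega>) (\<lambda>y. \<bar>f y\<bar>)\<bar>)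
          \<le> 2 * s * \<rho> powr \<beta> * measure lebesgue (cube x \<rho> \<inter> \<Omega>)"
        by (simp add: mult.assoc)
    qed (use assms f in \<open>auto simp: s_def\<close>)
    show S1
      unfolding S1_def AE_on using limit_mean_holder limit_mean_nonneg AE_eq_limit_mean by blast
  qed
  ultimately show ?thesis by blast
qed

end
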